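(* Let $(X,d)$ be a proper Polish metric space, let $p\in[1,\infty)$, let $r>0$, and let $\nu\in\mathcal{P}(X)$ be supported on $N$ atoms, that is, $\nu=\sum_{i=1}^N\alpha_i\,\delta_{y_i}$ with $N\ge 1$, $y_1,\dots,y_N\in X$, $\alpha_1,\dots,\alpha_N\ge 0$ and $\sum_{i=1}^N\alpha_i=1$ (so that $\nu$ has a finite $p$-th moment). Let $f:X\to\mathbb{R}$ be upper semi-continuous and such that for each $\mu\in\mathcal{B}_r(\nu)$ at least one of the integrals $\int_X[f(x)]_+\,\mathrm{d}\mu(x)$ and $\int_X[-f(x)]_+\,\mathrm{d}\mu(x)$ is finite. Suppose there exist $x_0\in X$, $c>0$ and $p'\in(0,p)$ such that $f(x)\le c\,[1+d^{p'}(x,x_0)]$ for all $x\in X$. Then the problem $$\text{maximize}\ \int_X f(x)\,\mathrm{d}\mu(x)\quad\text{subject to}\quad \mu\in\mathcal{B}_r(\nu)$$ has an optimal solution $\mu^\star\in\mathcal{B}_r(\nu)$ that is a probability measure supported on at most $N+1$ atoms.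
   Context: A Polish metric space is a complete and separable metric space. $(X,d)$ is proper if every closed ball $\{x\in X: d(x,x_0)\le R\}$, with $R>0$ and $x_0\in X$, is compact. $\mathcal{P}(X)$ is the set of all Borel probability measures on $X$, and $\delta_y$ is the Dirac measure at $y$. For $\mu_1,\mu_2\in\mathcal{P}(X)$, $$W_p(\mu_1,\mu_2)=\inf_{\gamma\in\Gamma(\mu_1,\mu_2)}\left(\int_{X\times X}d^p(x_1,x_2)\,\mathrm{d}\gamma(x_1,x_2)\right)^{1/p}\in[0,\infty],$$ where $\Gamma(\mu_1,\mu_2)$ is the set of probability measures on $X\times X$ with marginals $\mu_1$ and $\mu_2$. The Wasserstein ball is $\mathcal{B}_r(\nu)=\{\mu\in\mathcal{P}(X):W_p(\mu,\nu)\le r\}$. A measure $\mu\in\mathcal{P}(X)$ has a finite $p$-th moment if $\int_X d^p(x,x_0)\,\mathrm{d}\mu(x)<\infty$ for some (equivalently, every) $x_0\in X$. $[t]_+=\max\{t,0\}$. Integrals $\int_X f\,\mathrm{d}\mu=\int_X[f]_+\,\mathrm{d}\mu-\int_X[-f]_+\,\mathrm{d}\mu$ take values in $[-\infty,+\infty]$. A measure is supported on at most $m$ atoms if it is a non-negative combination of at most $m$ Dirac measures. *)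

theory Defs
  imports "HOL-Probability.Probability"
begin

definition borel_probs :: "'a::topological_space measure set" where
  "borel_probs = {\<mu>. sets \<mu> = sets borel \<and> prob_space \<mu>}"

text \<open>Finite non-negative combinations of Dirac measures; \<open>measure_of\<close> is used
  because the library has no sum of measures. The points need not be distinct.\<close>

definition dirac_comb :: "nat \<Rightarrow> (nat \<Rightarrow> real) \<Rightarrow> (nat \<Rightarrow> 'a::topological_space) \<Rightarrow> 'a measure" where
  "dirac_comb n \<alpha> y =
     measure_of UNIV (sets borel) (\<lambda>A. \<Sum>i=1..n. ennreal (\<alpha> i) * emeasure (return borel (y i)) A)"

lemma sets_dirac_comb [simp, measurable_cong]: "sets (dirac_comb n \<alpha> y) = sets borel"
  unfolding dirac_comb_def using sets.sets_measure_of_eq[of borel] by simp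

lemma space_dirac_comb [simp]: "space (dirac_comb n \<alpha> y) = UNIV"
  by (simp add: dirac_comb_def)

lemma emeasure_dirac_comb:
  assumes "A \<in> sets borel"
  shows "emeasure (dirac_comb n \<alpha> y) A = (\<Sum>i=1..n. ennreal (\<alpha> i) * indicator A (y i))"
proof -
  let ?m = "\<lambda>A. \<Sum>i=1..n. ennreal (\<alpha> i) * emeasure (return borel (y i)) A"
  have "countably_additive (sets borel) ?m"
  proof (rule countably_additiveI)
    fix B :: "nat \<Rightarrow> 'a set"
    assume B: "range B \<subseteq> sets borel" "disjoint_family B"
    have "(\<Sum>j. ?m (B j)) = (\<Sum>i=1..n. \<Sum>j. ennreal (\<alpha> i) * emeasure (return borel (y i)) (B j))"
      by (rule suminf_sum) (rule summableI)
    also have "\<dots> = ?m (\<Union>j. B j)"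
    proof (rule sum.cong[OF refl])
      fix i
      have "(\<Sum>j. emeasure (return borel (y i)) (B j)) = emeasure (return borel (y i)) (\<Union>j. B j)"
        using B by (intro suminf_emeasure) auto
      then show "(\<Sum>j. ennreal (\<alpha> i) * emeasure (return borel (y i)) (B j)) =
          ennreal (\<alpha> i) * emeasure (return borel (y i)) (\<Union>j. B j)"
        by (simp only: ennreal_suminf_cmult)
    qed
    finally show "(\<Sum>j. ?m (B j)) = ?m (\<Union>j. B j)" .
  qed
  moreover have "positive (sets borel) ?m"
    by (simp add: positive_def)
  moreover have "sigma_algebra UNIV (sets (borel :: 'a measure))"
    using sets.sigma_algebra_axioms[of "borel :: 'a measure"] by simp
  ultimately have "emeasure (dirac_comb n \<alpha> y) A = ?m A"
    unfolding dirac_comb_def using assms by (intro emeasure_measure_of_sigma)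
  then show ?thesis
    using assms by simp
qed

lemma dirac_comb_in_borel_probs:
  assumes "\<And>i. i \<in> {1..n} \<Longrightarrow> 0 \<le> \<alpha> i" "(\<Sum>i=1..n. \<alpha> i) = 1"
  shows "dirac_comb n \<alpha> y \<in> borel_probs"
proof -
  have "(\<Sum>i=1..n. ennreal (\<alpha> i)) = 1"
    using assms by (subst sum_ennreal) auto
  then show ?thesis
    by (auto simp: borel_probs_def emeasure_dirac_comb intro!: prob_spaceI)
qed

definition supported_on_at_most :: "nat \<Rightarrow> 'a::topological_space measure \<Rightarrow> bool" where
  "supported_on_at_most m \<mu> \<longleftrightarrow>
     (\<exists>n\<le>m. \<exists>\<alpha> y. (\<forall>i\<in>{1..n}. 0 \<le> \<alpha> i) \<and> \<mu> = dirac_comb n \<alpha> y)"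

definition couplings :: "'a::topological_space measure \<Rightarrow> 'a measure \<Rightarrow> ('a \<times> 'a) measure set" where
  "couplings \<mu>\<^sub>1 \<mu>\<^sub>2 = {\<gamma> \<in> borel_probs. distr \<gamma> borel fst = \<mu>\<^sub>1 \<and> distr \<gamma> borel snd = \<mu>\<^sub>2}"

text \<open>Real powers on \<open>[0, \<infinity>]\<close>, for positive exponents.\<close>

definition ennreal_powr :: "ennreal \<Rightarrow> real \<Rightarrow> ennreal" where
  "ennreal_powr t a = (if t = \<infinity> then \<infinity> else ennreal (enn2real t powr a))"

definition wasserstein :: "real \<Rightarrow> 'a::metric_space measure \<Rightarrow> 'a measure \<Rightarrow> ennreal" where
  "wasserstein p \<mu>\<^sub>1 \<mu>\<^sub>2 =
     (INF \<gamma>\<in>couplings \<mu>\<^sub>1 \<mu>\<^sub>2.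
        ennreal_powr (\<integral>\<^sup>+z. ennreal (dist (fst z) (snd z) powr p) \<partial>\<gamma>) (1 / p))"

definition wasserstein_ball :: "real \<Rightarrow> real \<Rightarrow> 'a::metric_space measure \<Rightarrow> 'a measure set" where
  "wasserstein_ball p r \<nu> = {\<mu> \<in> borel_probs. wasserstein p \<mu> \<nu> \<le> ennreal r}"

definition upper_semicontinuous :: "('a::topological_space \<Rightarrow> real) \<Rightarrow> bool" where
  "upper_semicontinuous f \<longleftrightarrow> (\<forall>x. \<forall>e>0. \<forall>\<^sub>F z in nhds x. f z < f x + e)"

text \<open>The Bochner integral would be \<open>0\<close> for non-integrable functions, hence this
  extended integral. It is meaningful only if one of the two parts is finite;
  in \<open>ereal\<close>, \<open>\<infinity> - \<infinity> = \<infinity>\<close>.\<close>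

definition ext_integral :: "'a measure \<Rightarrow> ('a \<Rightarrow> real) \<Rightarrow> ereal" where
  "ext_integral \<mu> f =
     enn2ereal (\<integral>\<^sup>+x. ennreal (max (f x) 0) \<partial>\<mu>) - enn2ereal (\<integral>\<^sup>+x. ennreal (max (- f x) 0) \<partial>\<mu>)"

end

theory Submission
  imports Defs "HOL-Real_Asymp.Real_Asymp"
begin

text \<open>
  The argument is Lagrangian duality on the transport cost. Fix a multiplier \<open>L \<ge> 0\<close> and call
  \<open>w\<close> a penalized maximizer at the node \<open>v\<close> if it maximizes \<open>x \<mapsto> f x - L * dist x v powr p\<close>.
  Suppose that some finite transport plan moves mass \<open>\<beta> j\<close> from the node \<open>v j\<close> of \<open>\<nu>\<close> to a penalized
  maximizer \<open>w j\<close>, and that it exhausts the budget \<open>r powr p\<close> unless \<open>L = 0\<close>. Integrating the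
  pointwise inequality \<open>f x \<le> g (v j) + L * dist x (v j) powr p\<close>, where \<open>g\<close> is the penalized
  maximum, against any almost optimal coupling shows that no measure in the ball does better than
  \<open>\<Sum>j. \<beta> j * f (w j)\<close> (\<open>transport_plan_optimal\<close>). So it suffices to find such a plan with at
  most \<open>N + 1\<close> moves.

  For each \<open>l > 0\<close> penalized maximizers exist: the growth of \<open>f\<close> has order less than \<open>p\<close>, so the
  penalized function tends to \<open>-\<infinity>\<close> and, closed balls being compact, its supremum is attained
  (\<open>penalized_maximizer_exists\<close>). Let \<open>D l\<close> be the cost of moving every node \<open>y i\<close> to such a
  maximizer, and let \<open>L\<close> be the infimum of the \<open>l > 0\<close> with \<open>D l \<le> r powr p\<close>. Penalized maximizers
  survive limits in the multiplier, so approaching \<open>L\<close> through multipliers with \<open>D l \<le> r powr p\<close>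
  gives maximizers \<open>b i\<close> of total cost at most \<open>r powr p\<close>, and approaching it from below
  (if \<open>L > 0\<close>) gives maximizers \<open>a i\<close> of total cost at least \<open>r powr p\<close>
  (\<open>critical_multiplier\<close>).

  If \<open>L = 0\<close>, the plan \<open>b\<close> already works, with \<open>N\<close> atoms. If \<open>L > 0\<close>, replace \<open>b i\<close> by \<open>a i\<close> one
  index after the other. The cost passes the budget at some index \<open>k\<close>, and splitting only the mass at
  \<open>y k\<close> between \<open>a k\<close> and \<open>b k\<close> meets the budget exactly. This one split is the extra atom.
\<close>

section \<open>Integration against finite combinations of Dirac measures\<close>

text \<open>
  The representation as an image of a measure on the index set handles repeated points and lets
  integrals be computed on a finite set.
\<close>

lemma dirac_comb_eq_distr:
  fixes y :: "nat \<Rightarrow> 'a::topological_space"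
  shows "dirac_comb n \<alpha> y = distr (point_measure {1..n} (\<lambda>i. ennreal (\<alpha> i))) borel y"
proof (rule measure_eqI)
  fix A :: "'a set" assume "A \<in> sets (dirac_comb n \<alpha> y)"
  then have A: "A \<in> sets borel" by simp
  have "emeasure (distr (point_measure {1..n} (\<lambda>i. ennreal (\<alpha> i))) borel y) A
      = (\<Sum>i\<in>y -` A \<inter> {1..n}. ennreal (\<alpha> i))"
    using A by (subst emeasure_distr) (auto simp: emeasure_point_measure_finite space_point_measure)
  also have "\<dots> = (\<Sum>i=1..n. ennreal (\<alpha> i) * indicator A (y i))"
    by (rule sum.mono_neutral_cong_left) (auto simp: indicator_def)
  finally show "emeasure (dirac_comb n \<alpha> y) A
      = emeasure (distr (point_measure {1..n} (\<lambda>i. ennreal (\<alpha> i))) borel y) A"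
    using A by (simp add: emeasure_dirac_comb)
qed simp

lemma nn_integral_dirac_comb:
  assumes "g \<in> borel_measurable borel"
  shows "(\<integral>\<^sup>+x. g x \<partial>dirac_comb n \<alpha> y) = (\<Sum>i=1..n. ennreal (\<alpha> i) * g (y i))"
  unfolding dirac_comb_eq_distr using assms
  by (subst nn_integral_distr) (auto simp: nn_integral_point_measure_finite)

lemma
  fixes g :: "'a::topological_space \<Rightarrow> real"
  assumes "g \<in> borel_measurable borel" "\<And>i. i \<in> {1..n} \<Longrightarrow> 0 \<le> \<alpha> i"
  shows integrable_dirac_comb: "integrable (dirac_comb n \<alpha> y) g"
    and integral_dirac_comb: "(\<integral>x. g x \<partial>dirac_comb n \<alpha> y) = (\<Sum>i=1..n. \<alpha> i * g (y i))"
proof -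
  have \<alpha>: "0 \<le> \<alpha> i" if "i \<in> {1..n}" for i using that by (rule assms(2))
  show "integrable (dirac_comb n \<alpha> y) g"
    unfolding dirac_comb_eq_distr using assms(1)
    by (auto simp: integrable_distr_eq integrable_point_measure_finite)
  show "(\<integral>x. g x \<partial>dirac_comb n \<alpha> y) = (\<Sum>i=1..n. \<alpha> i * g (y i))"
    unfolding dirac_comb_eq_distr using assms(1) \<alpha>
    by (subst integral_distr, simp, simp, subst lebesgue_integral_point_measure_finite) auto
qed

lemma distr_dirac_comb:
  assumes "h \<in> borel \<rightarrow>\<^sub>M borel"
  shows "distr (dirac_comb n \<alpha> w) borel h = dirac_comb n \<alpha> (\<lambda>i. h (w i))"
  unfolding dirac_comb_eq_distr using assms by (subst distr_distr) (auto simp: comp_def)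

lemma dirac_comb_eqI:
  fixes \<alpha> \<beta> :: "nat \<Rightarrow> real" and u v :: "nat \<Rightarrow> 'a::topological_space"
  assumes "\<And>i. i \<in> {1..m} \<Longrightarrow> 0 \<le> \<alpha> i" "\<And>j. j \<in> {1..n} \<Longrightarrow> 0 \<le> \<beta> j"
    and eq: "\<And>h :: 'a \<Rightarrow> real. (\<Sum>i=1..m. \<alpha> i * h (u i)) = (\<Sum>j=1..n. \<beta> j * h (v j))"
  shows "dirac_comb m \<alpha> u = dirac_comb n \<beta> v"
proof (rule measure_eqI)
  fix A :: "'a set" assume "A \<in> sets (dirac_comb m \<alpha> u)"
  then have A: "A \<in> sets borel" by simp
  have *: "emeasure (dirac_comb k \<eta> w) A = ennreal (\<Sum>j=1..k. \<eta> j * indicator A (w j))"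
    if "\<And>j. j \<in> {1..k} \<Longrightarrow> 0 \<le> \<eta> j" for k \<eta> and w :: "nat \<Rightarrow> 'a"
    unfolding emeasure_dirac_comb[OF A] using that
    by (subst sum_ennreal[symmetric]) (auto simp: ennreal_mult' ennreal_indicator intro!: sum.cong)
  show "emeasure (dirac_comb m \<alpha> u) A = emeasure (dirac_comb n \<beta> v) A"
    using assms by (simp only: *)
qed simp

text \<open>
  Points of weight zero must be excluded, because nothing is known about the penalized maximum at
  a node that carries no mass.
\<close>

lemma AE_dirac_comb_atoms:
  fixes y :: "nat \<Rightarrow> 'a::t1_space"
  assumes "\<And>i. i \<in> {1..n} \<Longrightarrow> 0 \<le> \<alpha> i"
  shows "AE x in dirac_comb n \<alpha> y. x \<in> y ` {i \<in> {1..n}. 0 < \<alpha> i}"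
proof -
  let ?Y = "y ` {i \<in> {1..n}. 0 < \<alpha> i}"
  have Y: "?Y \<in> sets borel" by (intro borel_closed finite_imp_closed) auto
  have "emeasure (dirac_comb n \<alpha> y) (- ?Y) = (\<Sum>i=1..n. ennreal (\<alpha> i) * indicator (- ?Y) (y i))"
    using Y by (intro emeasure_dirac_comb) auto
  also have "\<dots> = 0"
    using assms by (intro sum.neutral) (fastforce simp: indicator_def ennreal_eq_0_iff)
  finally show ?thesis
    using Y by (intro AE_I[of _ _ "- ?Y"]) auto
qed

lemma ennreal_max_zero: "ennreal (max t 0) = ennreal t"
  by (cases "0 \<le> t") (auto simp: max_def ennreal_neg)

lemma ext_integral_eq_integral:
  assumes "integrable M f"
  shows "ext_integral M f = ereal (\<integral>x. f x \<partial>M)"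
proof -
  have fin: "(\<integral>\<^sup>+x. ennreal (f x) \<partial>M) \<noteq> \<infinity>" "(\<integral>\<^sup>+x. ennreal (- f x) \<partial>M) \<noteq> \<infinity>"
    using assms by (auto simp: real_integrable_def)
  have e: "enn2ereal a = ereal (enn2real a)" if "a \<noteq> \<infinity>" for a
    using that by (cases a) (auto simp: enn2ereal_ennreal)
  show ?thesis
    unfolding ext_integral_def ennreal_max_zero real_lebesgue_integral_def[OF assms]
    using fin by (simp add: e)
qed

section \<open>Weak duality\<close>

lemma upper_semicontinuous_open_less:
  assumes "upper_semicontinuous f"
  shows "open {x. f x < a}"
proof (subst open_subopen, safe)
  fix x assume "f x < a"
  then have "\<forall>\<^sub>F z in nhds x. f z < f x + (a - f x)"
    using assms unfolding upper_semicontinuous_def by (metis diff_gt_0_iff_gt)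
  then show "\<exists>T. open T \<and> x \<in> T \<and> T \<subseteq> {x. f x < a}"
    by (auto simp: eventually_nhds)
qed

lemma upper_semicontinuous_borel_measurable:
  assumes "upper_semicontinuous f"
  shows "f \<in> borel_measurable borel"
  using upper_semicontinuous_open_less[OF assms] by (auto simp: borel_measurable_iff_less)

lemma borel_measurable_fst_snd [measurable]:
  "fst \<in> (borel :: ('a::topological_space \<times> 'a) measure) \<rightarrow>\<^sub>M borel"
  "snd \<in> (borel :: ('a::topological_space \<times> 'a) measure) \<rightarrow>\<^sub>M borel"
  by (auto intro!: borel_measurable_continuous_onI continuous_intros)

lemma borel_measurable_dist_powr:
  "(\<lambda>z::'a::metric_space \<times> 'a. dist (fst z) (snd z) powr p) \<in> borel_measurable borel"
  by (intro powr_real_measurable borel_measurable_const borel_measurable_continuous_onI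
      continuous_intros)

text \<open>
  The infimum that defines the Wasserstein distance need not be known to be attained; a coupling
  whose cost is within any larger budget \<open>s\<close> is enough, since \<open>s\<close> can tend to \<open>r\<close> at the end.
\<close>

lemma wasserstein_ball_coupling:
  fixes \<mu> :: "'a::metric_space measure"
  assumes "0 < p" "0 \<le> r" "\<mu> \<in> wasserstein_ball p r \<nu>" "r < s"
  obtains \<gamma> where "\<gamma> \<in> couplings \<mu> \<nu>"
    "integrable \<gamma> (\<lambda>z. dist (fst z) (snd z) powr p)"
    "(\<integral>z. dist (fst z) (snd z) powr p \<partial>\<gamma>) \<le> s powr p"
proof -
  let ?c = "\<lambda>z::'a \<times> 'a. dist (fst z) (snd z) powr p"
  have "wasserstein p \<mu> \<nu> < ennreal s"
    using assms by (auto simp: wasserstein_ball_def intro: le_less_trans ennreal_lessI)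
  then obtain \<gamma> where \<gamma>: "\<gamma> \<in> couplings \<mu> \<nu>"
    and less: "ennreal_powr (\<integral>\<^sup>+z. ennreal (?c z) \<partial>\<gamma>) (1 / p) < ennreal s"
    unfolding wasserstein_def INF_less_iff by blast
  let ?C = "\<integral>\<^sup>+z. ennreal (?c z) \<partial>\<gamma>"
  have fin: "?C \<noteq> \<infinity>" using less by (auto simp: ennreal_powr_def)
  have "sets \<gamma> = sets borel" using \<gamma> by (simp add: couplings_def borel_probs_def)
  then have meas: "?c \<in> borel_measurable \<gamma>"
    using borel_measurable_dist_powr by (simp cong: measurable_cong_sets)
  have "enn2real ?C powr (1 / p) < s"
    using less fin by (simp add: ennreal_powr_def ennreal_less_iff)
  then have "(enn2real ?C powr (1 / p)) powr p \<le> s powr p"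
    using assms by (intro powr_mono2) auto
  then have C: "enn2real ?C \<le> s powr p" using assms by (simp add: powr_powr)
  have "integrable \<gamma> ?c"
    using meas fin by (intro integrableI_nonneg) (auto simp: top.not_eq_extremum)
  moreover have "(\<integral>z. ?c z \<partial>\<gamma>) \<le> s powr p"
    using C meas by (subst integral_eq_nn_integral) auto
  ultimately show thesis using that \<gamma> by blast
qed

text \<open>
  Integrate the pointwise bound against a coupling of cost at most \<open>s powr p\<close> and let \<open>s\<close> decrease
  to \<open>r\<close>. The bound also makes the positive part of \<open>f\<close> integrable, so \<open>f\<close> is either integrable
  or has integral \<open>-\<infinity>\<close>, and in the latter case there is nothing to show.
\<close>

lemma ext_integral_le_dual_value:
  fixes f g :: "'a::metric_space \<Rightarrow> real"
  assumes f: "f \<in> borel_measurable borel" and g: "g \<in> borel_measurable borel"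
    and p: "0 < p" and r: "0 \<le> r" and l: "0 \<le> l"
    and \<beta>: "\<And>j. j \<in> {1..n} \<Longrightarrow> 0 \<le> \<beta> j"
    and \<mu>: "\<mu> \<in> wasserstein_ball p r (dirac_comb n \<beta> v)"
    and bound: "\<And>j x. j \<in> {1..n} \<Longrightarrow> 0 < \<beta> j \<Longrightarrow> f x \<le> g (v j) + l * dist x (v j) powr p"
  shows "ext_integral \<mu> f \<le> ereal ((\<Sum>j=1..n. \<beta> j * g (v j)) + l * r powr p)"
proof -
  let ?\<nu> = "dirac_comb n \<beta> v"
  let ?G = "\<Sum>j=1..n. \<beta> j * g (v j)"
  let ?c = "\<lambda>z::'a \<times> 'a. dist (fst z) (snd z) powr p"
  have sets_\<mu>: "sets \<mu> = sets borel"
    using \<mu> by (auto simp: wasserstein_ball_def borel_probs_def)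
  have f\<mu>: "f \<in> borel_measurable \<mu>" using f sets_\<mu> by (simp cong: measurable_cong_sets)
  have step: "ext_integral \<mu> f \<le> ereal (?G + l * s powr p)" if s: "r < s" for s
  proof -
    obtain \<gamma> where \<gamma>: "\<gamma> \<in> couplings \<mu> ?\<nu>" and ci: "integrable \<gamma> ?c"
      and cs: "(\<integral>z. ?c z \<partial>\<gamma>) \<le> s powr p"
      using wasserstein_ball_coupling[OF p r \<mu> s] by blast
    have sets_\<gamma>: "sets \<gamma> = sets borel" and fst_\<gamma>: "distr \<gamma> borel fst = \<mu>"
      and snd_\<gamma>: "distr \<gamma> borel snd = ?\<nu>"
      using \<gamma> by (auto simp: couplings_def borel_probs_def)
    have mf: "fst \<in> \<gamma> \<rightarrow>\<^sub>M borel" and ms: "snd \<in> \<gamma> \<rightarrow>\<^sub>M borel"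
      using sets_\<gamma> by (simp_all cong: measurable_cong_sets)
    have gi: "integrable \<gamma> (\<lambda>z. g (snd z))"
      using integrable_dirac_comb[OF g, of n \<beta> v] \<beta>
      unfolding snd_\<gamma>[symmetric] using integrable_distr_eq[OF ms g] by simp
    have gG: "(\<integral>z. g (snd z) \<partial>\<gamma>) = ?G"
      using integral_distr[OF ms g] integral_dirac_comb[OF g, of n \<beta> v] \<beta>
      unfolding snd_\<gamma> by simp
    let ?u = "\<lambda>z. g (snd z) + l * ?c z"
    have ui: "integrable \<gamma> ?u" using gi ci by simp
    have "AE z in \<gamma>. snd z \<in> v ` {j \<in> {1..n}. 0 < \<beta> j}"
      using AE_dirac_comb_atoms[of n \<beta> v, OF \<beta>] unfolding snd_\<gamma>[symmetric]
      by (rule AE_distrD[OF ms])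
    then have fu: "AE z in \<gamma>. f (fst z) \<le> ?u z"
      by eventually_elim (use bound in force)
    have "(\<integral>\<^sup>+x. ennreal (f x) \<partial>\<mu>) = (\<integral>\<^sup>+z. ennreal (f (fst z)) \<partial>\<gamma>)"
      unfolding fst_\<gamma>[symmetric] using f by (intro nn_integral_distr[OF mf]) auto
    also have "\<dots> \<le> (\<integral>\<^sup>+z. ennreal (?u z) \<partial>\<gamma>)"
      using fu by (intro nn_integral_mono_AE) (auto intro: ennreal_leI elim!: eventually_mono)
    also have "\<dots> < \<infinity>" using ui by (auto simp: real_integrable_def top.not_eq_extremum)
    finally have plus: "(\<integral>\<^sup>+x. ennreal (f x) \<partial>\<mu>) < \<infinity>" .
    show ?thesis
    proof (cases "integrable \<mu> f")
      case True
      have fi: "integrable \<gamma> (\<lambda>z. f (fst z))"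
        using True unfolding fst_\<gamma>[symmetric] using integrable_distr_eq[OF mf f] by simp
      have "(\<integral>x. f x \<partial>\<mu>) = (\<integral>z. f (fst z) \<partial>\<gamma>)"
        unfolding fst_\<gamma>[symmetric] by (rule integral_distr[OF mf f])
      also have "\<dots> \<le> (\<integral>z. ?u z \<partial>\<gamma>)" by (rule integral_mono_AE[OF fi ui fu])
      also have "\<dots> = ?G + l * (\<integral>z. ?c z \<partial>\<gamma>)" using gi ci by (simp add: gG)
      also have "\<dots> \<le> ?G + l * s powr p" using cs l by (simp add: mult_left_mono)
      finally show ?thesis using True by (simp add: ext_integral_eq_integral)
    next
      case False
      have "(\<integral>\<^sup>+x. ennreal (- f x) \<partial>\<mu>) = \<infinity>"
        using False f\<mu> plus by (auto simp: real_integrable_def)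
      then have "ext_integral \<mu> f = -\<infinity>"
        unfolding ext_integral_def ennreal_max_zero using plus by (cases "\<integral>\<^sup>+x. ennreal (f x) \<partial>\<mu>") auto
      then show ?thesis by simp
    qed
  qed
  have "((\<lambda>s. ?G + l * s powr p) \<longlongrightarrow> ?G + l * r powr p) (at_right r)"
    by (intro tendsto_intros tendsto_powr') (use p r in \<open>auto simp: eventually_at_filter\<close>)
  then have "((\<lambda>s. ereal (?G + l * s powr p)) \<longlongrightarrow> ereal (?G + l * r powr p)) (at_right r)"
    by simp
  then show ?thesis
    by (rule tendsto_lowerbound)
      (use step in \<open>auto simp: eventually_at_filter intro!: always_eventually\<close>)
qed

text \<open>
  The plan that moves mass \<open>\<beta> j\<close> from \<open>v j\<close> to \<open>w j\<close> is itself a coupling.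
\<close>

lemma dirac_comb_in_wasserstein_ball:
  fixes w v :: "nat \<Rightarrow> 'a::metric_space"
  assumes p: "0 < p" and r: "0 \<le> r"
    and \<beta>: "\<And>j. j \<in> {1..n} \<Longrightarrow> 0 \<le> \<beta> j" and \<beta>1: "(\<Sum>j=1..n. \<beta> j) = 1"
    and cost: "(\<Sum>j=1..n. \<beta> j * dist (w j) (v j) powr p) \<le> r powr p"
  shows "dirac_comb n \<beta> w \<in> wasserstein_ball p r (dirac_comb n \<beta> v)"
proof -
  let ?\<gamma> = "dirac_comb n \<beta> (\<lambda>j. (w j, v j))"
  let ?C = "\<Sum>j=1..n. \<beta> j * dist (w j) (v j) powr p"
  have \<gamma>: "?\<gamma> \<in> couplings (dirac_comb n \<beta> w) (dirac_comb n \<beta> v)"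
    using dirac_comb_in_borel_probs[OF \<beta> \<beta>1]
    by (simp add: couplings_def distr_dirac_comb borel_measurable_fst_snd)
  have C0: "0 \<le> ?C" using \<beta> by (intro sum_nonneg) auto
  have "(\<integral>\<^sup>+z. ennreal (dist (fst z) (snd z) powr p) \<partial>?\<gamma>)
      = (\<Sum>j=1..n. ennreal (\<beta> j) * ennreal (dist (w j) (v j) powr p))"
    using borel_measurable_dist_powr by (subst nn_integral_dirac_comb) auto
  also have "\<dots> = ennreal ?C"
    using \<beta> by (subst sum_ennreal[symmetric]) (auto simp: ennreal_mult' intro!: sum.cong)
  finally have I: "(\<integral>\<^sup>+z. ennreal (dist (fst z) (snd z) powr p) \<partial>?\<gamma>) = ennreal ?C" .
  have "?C powr (1 / p) \<le> (r powr p) powr (1 / p)"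
    using cost C0 p by (intro powr_mono2) auto
  then have "?C powr (1 / p) \<le> r" using p r by (simp add: powr_powr)
  then have "ennreal_powr (ennreal ?C) (1 / p) \<le> ennreal r"
    using C0 by (simp add: ennreal_powr_def ennreal_leI)
  then have "wasserstein p (dirac_comb n \<beta> w) (dirac_comb n \<beta> v) \<le> ennreal r"
    unfolding wasserstein_def using \<gamma> I by (intro INF_lower2[OF \<gamma>]) simp
  then show ?thesis
    using dirac_comb_in_borel_probs[OF \<beta> \<beta>1] by (simp add: wasserstein_ball_def)
qed

definition penalized_maximizer ::
    "real \<Rightarrow> ('a::metric_space \<Rightarrow> real) \<Rightarrow> real \<Rightarrow> 'a \<Rightarrow> 'a \<Rightarrow> bool" where
  "penalized_maximizer p f l v w \<longleftrightarrow>
     (\<forall>x. f x - l * dist x v powr p \<le> f w - l * dist w v powr p)"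

text \<open>
  The certificate of optimality: \<open>slack\<close> is complementary slackness, which makes the dual bound
  equal to the value of the plan.
\<close>

lemma transport_plan_optimal:
  fixes f :: "'a::metric_space \<Rightarrow> real"
  assumes f: "f \<in> borel_measurable borel"
    and p: "0 < p" and r: "0 \<le> r" and l: "0 \<le> l"
    and \<beta>: "\<And>j. j \<in> {1..n} \<Longrightarrow> 0 \<le> \<beta> j"
    and max: "\<And>j. j \<in> {1..n} \<Longrightarrow> 0 < \<beta> j \<Longrightarrow> penalized_maximizer p f l (v j) (w j)"
    and slack: "l = 0 \<or> (\<Sum>j=1..n. \<beta> j * dist (w j) (v j) powr p) = r powr p"
    and \<mu>: "\<mu> \<in> wasserstein_ball p r (dirac_comb n \<beta> v)"
  shows "ext_integral \<mu> f \<le> ext_integral (dirac_comb n \<beta> w) f"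
proof -
  define Y where "Y = v ` {j \<in> {1..n}. 0 < \<beta> j}"
  \<comment> \<open>The penalized maximum, as a function of the node and not of the index, since nodes may repeat.
    It is cut off outside the finite set \<open>Y\<close> to make it evidently measurable.\<close>
  define g where "g u = (if u \<in> Y then SUP x. f x - l * dist x u powr p else 0)" for u
  have "finite Y" by (simp add: Y_def)
  then have g: "g \<in> borel_measurable borel"
    by (intro measurable_discrete_difference[of "\<lambda>_. 0" _ _ Y g])
      (auto simp: g_def intro: countable_finite)
  have g_eq: "g (v j) = f (w j) - l * dist (w j) (v j) powr p" if "j \<in> {1..n}" "0 < \<beta> j" for j
  proof -
    have "v j \<in> Y" using that by (auto simp: Y_def)
    then show ?thesis
      using max[OF that] unfolding g_def penalized_maximizer_def
      by (auto intro!: cSup_eq_maximum)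
  qed
  have "ext_integral \<mu> f \<le> ereal ((\<Sum>j=1..n. \<beta> j * g (v j)) + l * r powr p)"
  proof (rule ext_integral_le_dual_value[OF f g p r l \<beta> \<mu>])
    fix j x assume j: "j \<in> {1..n}" "0 < \<beta> j"
    show "f x \<le> g (v j) + l * dist x (v j) powr p"
      using max[OF j] unfolding g_eq[OF j] penalized_maximizer_def by (auto simp: algebra_simps)
  qed auto
  also have "(\<Sum>j=1..n. \<beta> j * g (v j))
      = (\<Sum>j=1..n. \<beta> j * f (w j) - l * (\<beta> j * dist (w j) (v j) powr p))"
  proof (rule sum.cong[OF refl])
    fix j assume j: "j \<in> {1..n}"
    show "\<beta> j * g (v j) = \<beta> j * f (w j) - l * (\<beta> j * dist (w j) (v j) powr p)"
      using \<beta>[OF j] by (cases "\<beta> j = 0") (auto simp: g_eq[OF j] right_diff_distrib)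
  qed
  also have "\<dots> = (\<Sum>j=1..n. \<beta> j * f (w j)) - l * (\<Sum>j=1..n. \<beta> j * dist (w j) (v j) powr p)"
    by (simp add: sum_subtractf sum_distrib_left)
  also have "\<dots> + l * r powr p = (\<Sum>j=1..n. \<beta> j * f (w j))" using slack by auto
  also have "ereal \<dots> = ext_integral (dirac_comb n \<beta> w) f"
    using integrable_dirac_comb[OF f, of n \<beta> w] \<beta> integral_dirac_comb[OF f, of n \<beta> w] \<beta>
    by (simp add: ext_integral_eq_integral)
  finally show ?thesis .
qed

section \<open>Penalized maximizers\<close>

text \<open>
  If every point \<open>x\<close> of \<open>K\<close> were beaten by some \<open>Z x\<close>, then \<open>Z x\<close> would beat a whole neighbourhood
  of \<open>x\<close>. Finitely many such neighbourhoods cover \<open>K\<close>, and the best of the corresponding \<open>Z x\<close>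
  would beat itself.
\<close>

lemma upper_semicontinuous_attains_max:
  fixes g :: "'a::topological_space \<Rightarrow> real"
  assumes usc: "upper_semicontinuous g" and K: "compact K" "K \<noteq> {}"
  shows "\<exists>w\<in>K. \<forall>x\<in>K. g x \<le> g w"
proof (rule ccontr)
  assume "\<not> ?thesis"
  then obtain Z where Z: "\<And>x. x \<in> K \<Longrightarrow> Z x \<in> K \<and> g x < g (Z x)"
    by (metis not_le)
  obtain C where C: "C \<subseteq> K" "finite C" "K \<subseteq> (\<Union>x\<in>C. {u. g u < g (Z x)})"
    using Z by (rule_tac compactE_image[OF K(1), of K "\<lambda>x. {u. g u < g (Z x)}"])
      (auto intro: upper_semicontinuous_open_less[OF usc])
  have "C \<noteq> {}" using C K by auto
  then obtain x where x: "x \<in> C" "\<forall>x'\<in>C. g (Z x') \<le> g (Z x)"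
    using obtains_MAX[OF C(2), of "g \<circ> Z"] C(2) by (metis Max_ge comp_apply finite_imageI imageI)
  then have "Z x \<in> K" using C Z by auto
  then show False using C(3) x by force
qed

text \<open>
  Far away from \<open>v\<close> the penalty dominates and the penalized function falls below \<open>f v\<close>, its value
  at \<open>v\<close>; so a maximizer over a large closed ball is a global one.
\<close>

lemma penalized_maximizer_exists:
  fixes f :: "'a::metric_space \<Rightarrow> real"
  assumes proper: "\<And>(x::'a) R. R > 0 \<Longrightarrow> compact (cball x R)"
    and usc: "upper_semicontinuous f"
    and c: "0 \<le> c" and q: "0 < q" "q < p"
    and growth: "\<And>x. f x \<le> c * (1 + dist x x\<^sub>0 powr q)"
    and l: "0 < l"
  shows "\<exists>w. penalized_maximizer p f l v w"
proof -
  let ?g = "\<lambda>x. f x - l * dist x v powr p"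
  have uscg: "upper_semicontinuous ?g"
    unfolding upper_semicontinuous_def
  proof safe
    fix x :: 'a and e :: real assume e: "0 < e"
    have "((\<lambda>z. l * dist z v powr p) \<longlongrightarrow> l * dist x v powr p) (nhds x)"
      by (intro tendsto_intros tendsto_powr' filterlim_ident) (use q in auto)
    then have "\<forall>\<^sub>F z in nhds x. l * dist x v powr p - e/2 < l * dist z v powr p"
      using e by (intro order_tendstoD) auto
    moreover have "\<forall>\<^sub>F z in nhds x. f z < f x + e/2"
      using usc e unfolding upper_semicontinuous_def by (meson half_gt_zero)
    ultimately show "\<forall>\<^sub>F z in nhds x. ?g z < ?g x + e"
      by eventually_elim (simp add: field_simps)
  qed
  have "\<forall>\<^sub>F t in at_top. c * (1 + (t + dist v x\<^sub>0) powr q) - l * t powr p < f v"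
    using q l by real_asymp
  then obtain T where T: "\<And>t. T \<le> t \<Longrightarrow> c * (1 + (t + dist v x\<^sub>0) powr q) - l * t powr p < f v"
    by (auto simp: eventually_at_top_linorder)
  define R where "R = max T 1"
  have "\<exists>w\<in>cball v R. \<forall>x\<in>cball v R. ?g x \<le> ?g w"
    by (intro upper_semicontinuous_attains_max[OF uscg] proper) (auto simp: R_def)
  then obtain w where w: "\<And>x. x \<in> cball v R \<Longrightarrow> ?g x \<le> ?g w" by blast
  have "?g x \<le> ?g w" for x
  proof (cases "x \<in> cball v R")
    case False
    then have t: "T \<le> dist x v" by (auto simp: R_def dist_commute)
    have "dist x x\<^sub>0 powr q \<le> (dist x v + dist v x\<^sub>0) powr q"
      using q by (intro powr_mono2 dist_triangle) auto
    then have "c * (1 + dist x x\<^sub>0 powr q) \<le> c * (1 + (dist x v + dist v x\<^sub>0) powr q)"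
      using c by (intro mult_left_mono) auto
    then have "?g x \<le> f v" using growth[of x] T[OF t] by simp
    also have "\<dots> \<le> ?g w" using w[of v] by (simp add: R_def)
    finally show ?thesis .
  qed (rule w)
  then show ?thesis by (auto simp: penalized_maximizer_def)
qed

text \<open>
  Upper semicontinuity is exactly what is needed: the competitor's value and the penalty converge,
  while \<open>f w\<close> is at least the upper limit of \<open>f (x n)\<close>.
\<close>

lemma penalized_maximizer_limit:
  fixes f :: "'a::metric_space \<Rightarrow> real"
  assumes usc: "upper_semicontinuous f" and p: "0 < p"
    and l: "l \<longlonglongrightarrow> L" and x: "x \<longlonglongrightarrow> w"
    and max: "\<And>n. penalized_maximizer p f (l n) v (x n)"
  shows "penalized_maximizer p f L v w"
  unfolding penalized_maximizer_def
proof
  fix z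
  have "f z - L * dist z v powr p + L * dist w v powr p \<le> f w + e" if e: "0 < e" for e
  proof (rule tendsto_upperbound)
    show "(\<lambda>n. f z - l n * dist z v powr p + l n * dist (x n) v powr p)
        \<longlonglongrightarrow> f z - L * dist z v powr p + L * dist w v powr p"
      by (intro tendsto_intros tendsto_powr' l x) (use p in auto)
    have "\<forall>\<^sub>F u in nhds w. f u < f w + e"
      using usc e unfolding upper_semicontinuous_def by blast
    then have "\<forall>\<^sub>F n in sequentially. f (x n) < f w + e"
      using x by (rule eventually_compose_filterlim)
    then show "\<forall>\<^sub>F n in sequentially.
        f z - l n * dist z v powr p + l n * dist (x n) v powr p \<le> f w + e"
    proof eventually_elim
      case (elim n)
      have "f z - l n * dist z v powr p \<le> f (x n) - l n * dist (x n) v powr p"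
        using max by (auto simp: penalized_maximizer_def)
      then show ?case using elim by linarith
    qed
  qed simp
  then have "f z - L * dist z v powr p + L * dist w v powr p \<le> f w"
    by (rule field_le_epsilon)
  then show "f z - L * dist z v powr p \<le> f w - L * dist w v powr p" by simp
qed

text \<open>
  Compare \<open>x\<close> with \<open>x'\<close> under the penalty \<open>m\<close> and \<open>v\<close> with \<open>x\<close> under the penalty \<open>l\<close>. For \<open>m\<close> fixed
  this bounds the maximizers for all \<open>l\<close> beyond a fixed value above \<open>m\<close>, and shows that their cost vanishes as
  \<open>l\<close> grows.
\<close>

lemma penalized_maximizer_dist_bound:
  assumes "penalized_maximizer p f m v x'" "penalized_maximizer p f l v x" "0 \<le> m"
  shows "(l - m) * dist x v powr p \<le> f x' - f v"
proof -
  have "f x - m * dist x v powr p \<le> f x' - m * dist x' v powr p"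
    using assms(1) by (auto simp: penalized_maximizer_def)
  moreover have "f v \<le> f x - l * dist x v powr p"
    using assms(2) unfolding penalized_maximizer_def by (metis dist_self mult_zero_right diff_zero powr_0)
  moreover have "0 \<le> m * dist x' v powr p" using assms(3) by simp
  ultimately show ?thesis by (simp add: algebra_simps)
qed

lemma simultaneous_convergent_subsequence:
  fixes X :: "nat \<Rightarrow> 'i \<Rightarrow> 'a::metric_space"
  assumes "finite I" "\<And>i. i \<in> I \<Longrightarrow> compact (K i)" "\<And>i n. i \<in> I \<Longrightarrow> X n i \<in> K i"
  shows "\<exists>s w. strict_mono s \<and> (\<forall>i\<in>I. (\<lambda>n. X (s n) i) \<longlonglongrightarrow> w i)"
  using assms
proof (induction I rule: finite_induct)
  case empty
  then show ?case by (auto intro!: exI[of _ id] strict_mono_id)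
next
  case (insert j I)
  have "\<exists>s w. strict_mono s \<and> (\<forall>i\<in>I. (\<lambda>n. X (s n) i) \<longlonglongrightarrow> w i)"
    using insert.prems by (intro insert.IH) auto
  then obtain s w where s: "strict_mono s" "\<And>i. i \<in> I \<Longrightarrow> (\<lambda>n. X (s n) i) \<longlonglongrightarrow> w i"
    by blast
  have "seq_compact (K j)" "\<forall>n. X (s n) j \<in> K j"
    using insert.prems by (auto intro: compact_imp_seq_compact)
  then obtain a t where t: "strict_mono t" "((\<lambda>n. X (s n) j) \<circ> t) \<longlonglongrightarrow> a"
    by (rule seq_compactE)
  have "(\<lambda>n. X (s (t n)) i) \<longlonglongrightarrow> w i" if "i \<in> I" for i
    using LIMSEQ_subseq_LIMSEQ[OF s(2)[OF that] t(1)] by (simp add: comp_def)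
  moreover have "(\<lambda>n. X (s (t n)) j) \<longlonglongrightarrow> a" using t(2) by (simp add: comp_def)
  ultimately have "\<forall>i\<in>insert j I. (\<lambda>n. X ((s \<circ> t) n) i) \<longlonglongrightarrow> (w(j := a)) i"
    using insert.hyps by auto
  moreover have "strict_mono (s \<circ> t)" using s(1) t(1) by (rule strict_mono_o)
  ultimately show ?case by blast
qed

text \<open>
  A plan of penalized maximizers converges along a subsequence, with its cost, to a plan of
  penalized maximizers for the limiting multiplier. Nodes of weight zero are left out: they do not
  contribute to the cost, so a bound on the cost does not confine their images.
\<close>

lemma limiting_maximizers:
  fixes f :: "'a::metric_space \<Rightarrow> real" and X :: "nat \<Rightarrow> nat \<Rightarrow> 'a"
  assumes proper: "\<And>(x::'a) R. R > 0 \<Longrightarrow> compact (cball x R)"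
    and usc: "upper_semicontinuous f" and p: "0 < p"
    and l: "l \<longlonglongrightarrow> L" and \<alpha>: "\<And>i. i \<in> {1..N} \<Longrightarrow> 0 \<le> \<alpha> i"
    and max: "\<And>n i. i \<in> {1..N} \<Longrightarrow> penalized_maximizer p f (l n) (y i) (X n i)"
    and bounded: "\<And>i n. i \<in> {1..N} \<Longrightarrow> 0 < \<alpha> i \<Longrightarrow> dist (X n i) (y i) powr p \<le> B i"
  shows "\<exists>s w. strict_mono s \<and>
     (\<forall>i\<in>{1..N}. 0 < \<alpha> i \<longrightarrow> penalized_maximizer p f L (y i) (w i)) \<and>
     (\<lambda>n. \<Sum>i=1..N. \<alpha> i * dist (X (s n) i) (y i) powr p)
        \<longlonglongrightarrow> (\<Sum>i=1..N. \<alpha> i * dist (w i) (y i) powr p)"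
proof -
  define I where "I = {i \<in> {1..N}. 0 < \<alpha> i}"
  have "X n i \<in> cball (y i) (B i powr (1/p) + 1)" if "i \<in> I" for i n
  proof -
    have "(dist (X n i) (y i) powr p) powr (1/p) \<le> B i powr (1/p)"
      using bounded[of i n] that p by (intro powr_mono2) (auto simp: I_def)
    then show ?thesis using p by (simp add: powr_powr dist_commute)
  qed
  moreover have "compact (cball (y i) (B i powr (1/p) + 1))" for i
    by (rule proper) (simp add: add_nonneg_pos)
  ultimately obtain s w where s: "strict_mono s"
    and w: "\<And>i. i \<in> I \<Longrightarrow> (\<lambda>n. X (s n) i) \<longlonglongrightarrow> w i"
    using simultaneous_convergent_subsequence[of I "\<lambda>i. cball (y i) (B i powr (1/p) + 1)" X]
    by (auto simp: I_def)
  have "penalized_maximizer p f L (y i) (w i)" if "i \<in> I" for i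
    using that LIMSEQ_subseq_LIMSEQ[OF l s] max
    by (intro penalized_maximizer_limit[OF usc p _ w[OF that], of "l \<circ> s"]) (auto simp: I_def)
  moreover have "(\<lambda>n. \<alpha> i * dist (X (s n) i) (y i) powr p) \<longlonglongrightarrow> \<alpha> i * dist (w i) (y i) powr p"
    if "i \<in> {1..N}" for i
  proof (cases "\<alpha> i = 0")
    case False
    then have "i \<in> I" using that \<alpha>[OF that] by (simp add: I_def)
    then show ?thesis
      by (intro tendsto_intros tendsto_powr' w) (use p in auto)
  qed simp
  ultimately show ?thesis
    using s by (intro exI[of _ s] exI[of _ w]) (auto simp: I_def intro!: tendsto_sum)
qed

section \<open>The critical multiplier\<close>

text \<open>
  The threshold between multipliers that are too cheap and those that are expensive enough. The
  cost may jump at a positive threshold, which is why two plans are produced there, one on either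
  side of the budget.
\<close>

lemma critical_multiplier:
  fixes f :: "'a::metric_space \<Rightarrow> real"
    and y :: "nat \<Rightarrow> 'a" and \<alpha> :: "nat \<Rightarrow> real"
  assumes proper: "\<And>(x::'a) R. R > 0 \<Longrightarrow> compact (cball x R)"
    and usc: "upper_semicontinuous f" and p: "0 < p" and R: "0 < R"
    and \<alpha>: "\<And>i. i \<in> {1..N} \<Longrightarrow> 0 \<le> \<alpha> i"
    and ex: "\<And>l v. 0 < l \<Longrightarrow> \<exists>w. penalized_maximizer p f l v w"
  obtains L a b where "0 \<le> L"
    "\<And>i. i \<in> {1..N} \<Longrightarrow> 0 < \<alpha> i \<Longrightarrow> penalized_maximizer p f L (y i) (b i)"
    "(\<Sum>i=1..N. \<alpha> i * dist (b i) (y i) powr p) \<le> R"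
    "0 < L \<Longrightarrow> R \<le> (\<Sum>i=1..N. \<alpha> i * dist (a i) (y i) powr p)"
    "\<And>i. 0 < L \<Longrightarrow> i \<in> {1..N} \<Longrightarrow> 0 < \<alpha> i \<Longrightarrow> penalized_maximizer p f L (y i) (a i)"
proof -
  obtain X where X: "\<And>l v. 0 < l \<Longrightarrow> penalized_maximizer p f l v (X l v)"
    using ex by metis
  define D where "D l = (\<Sum>i=1..N. \<alpha> i * dist (X l (y i)) (y i) powr p)" for l
  define S where "S = {l. 0 < l \<and> D l \<le> R}"
  define K where "K = (\<Sum>i=1..N. \<alpha> i * (f (X 1 (y i)) - f (y i)))"
  have K: "(l - 1) * D l \<le> K" if "0 < l" for l
    unfolding D_def K_def sum_distrib_left
    using penalized_maximizer_dist_bound[OF X X, of 1 l] that \<alpha>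
    by (intro sum_mono) (simp add: mult.left_commute mult_left_mono)
  have "0 \<le> K" using K[of 1] by simp
  \<comment> \<open>By \<open>K\<close> the cost decays like \<open>K / (l - 1)\<close>; \<open>T\<close> is chosen to make this at most \<open>R\<close>.\<close>
  define T where "T = K / R + 1"
  have T: "0 < T" using \<open>0 \<le> K\<close> R by (simp add: T_def add_nonneg_pos)
  have "T * D (1 + T) \<le> K" using K[of "1 + T"] T by simp
  also have "K \<le> T * R" using R by (simp add: T_def field_simps)
  finally have "1 + T \<in> S" using T by (simp add: S_def)
  then have ne: "S \<noteq> {}" by blast
  have bdd: "bdd_below S" by (auto simp: S_def intro!: bdd_belowI[of _ 0])
  define L where "L = Inf S"
  have L0: "0 \<le> L" unfolding L_def using ne by (intro cInf_greatest) (auto simp: S_def)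
  have "L \<in> closure S" unfolding L_def using ne bdd by (rule closure_contains_Inf)
  then obtain l where l: "\<And>n. l n \<in> S" "l \<longlonglongrightarrow> L" by (auto simp: closure_sequential)
  have term_le: "\<alpha> i * dist (X (l n) (y i)) (y i) powr p \<le> R" if "i \<in> {1..N}" for i n
  proof -
    have "\<alpha> i * dist (X (l n) (y i)) (y i) powr p \<le> D (l n)"
      unfolding D_def using that \<alpha> by (intro member_le_sum) auto
    also have "\<dots> \<le> R" using l(1)[of n] by (simp add: S_def)
    finally show ?thesis .
  qed
  have "\<exists>s b. strict_mono s \<and>
     (\<forall>i\<in>{1..N}. 0 < \<alpha> i \<longrightarrow> penalized_maximizer p f L (y i) (b i)) \<and>
     (\<lambda>n. D (l (s n))) \<longlonglongrightarrow> (\<Sum>i=1..N. \<alpha> i * dist (b i) (y i) powr p)"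
    unfolding D_def
  proof (rule limiting_maximizers[OF proper usc p l(2) \<alpha>, where B = "\<lambda>i. R / \<alpha> i"])
    show "penalized_maximizer p f (l n) (y i) (X (l n) (y i))" for n i
      using l(1)[of n] by (intro X) (simp add: S_def)
    show "dist (X (l n) (y i)) (y i) powr p \<le> R / \<alpha> i" if "i \<in> {1..N}" "0 < \<alpha> i" for i n
      using term_le[OF that(1)] that(2) by (simp add: field_simps)
  qed auto
  then obtain s b where
    b: "\<And>i. i \<in> {1..N} \<Longrightarrow> 0 < \<alpha> i \<Longrightarrow> penalized_maximizer p f L (y i) (b i)"
    and b_lim: "(\<lambda>n. D (l (s n))) \<longlonglongrightarrow> (\<Sum>i=1..N. \<alpha> i * dist (b i) (y i) powr p)"
    by blast
  have b_cost: "(\<Sum>i=1..N. \<alpha> i * dist (b i) (y i) powr p) \<le> R"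
    using l(1) by (intro LIMSEQ_le_const2[OF b_lim]) (auto simp: S_def)
  show thesis
  proof (cases "L = 0")
    case True
    then show ?thesis using that[of L b b] b b_cost by simp
  next
    case False
    then have Lpos: "0 < L" using L0 by simp
    \<comment> \<open>A sequence in \<open>{L / 2..<L}\<close>, hence outside \<open>S\<close>; comparing with the multiplier \<open>L / 4\<close>,
      which lies strictly below the whole sequence, keeps its maximizers bounded.\<close>
    define m where "m n = L * (1 - 1 / (real n + 2))" for n
    have m_ge: "L / 2 \<le> m n" and m_less: "m n < L" for n
      using Lpos by (simp_all add: m_def field_simps)
    have m_pos: "0 < m n" for n using m_ge[of n] Lpos by linarith
    have m_lim: "m \<longlonglongrightarrow> L" unfolding m_def by real_asymp
    have D_gt: "R < D (m n)" for n
      using m_less[of n] m_pos[of n] cInf_lower[OF _ bdd, of "m n"]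
      by (force simp: S_def L_def not_le)
    have "\<exists>s a. strict_mono s \<and>
       (\<forall>i\<in>{1..N}. 0 < \<alpha> i \<longrightarrow> penalized_maximizer p f L (y i) (a i)) \<and>
       (\<lambda>n. D (m (s n))) \<longlonglongrightarrow> (\<Sum>i=1..N. \<alpha> i * dist (a i) (y i) powr p)"
      unfolding D_def
    proof (rule limiting_maximizers[OF proper usc p m_lim \<alpha>,
          where B = "\<lambda>i. (f (X (L/4) (y i)) - f (y i)) / (L/4)"])
      show "penalized_maximizer p f (m n) (y i) (X (m n) (y i))" for n i
        by (rule X[OF m_pos])
      show "dist (X (m n) (y i)) (y i) powr p \<le> (f (X (L/4) (y i)) - f (y i)) / (L/4)" for i n
      proof -
        have "L/4 * dist (X (m n) (y i)) (y i) powr p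
            \<le> (m n - L/4) * dist (X (m n) (y i)) (y i) powr p"
          using m_ge[of n] by (intro mult_right_mono) auto
        also have "\<dots> \<le> f (X (L/4) (y i)) - f (y i)"
          using Lpos m_pos by (intro penalized_maximizer_dist_bound X) auto
        finally show ?thesis using Lpos by (simp add: field_simps)
      qed
    qed auto
    then obtain s' a where
      a: "\<And>i. i \<in> {1..N} \<Longrightarrow> 0 < \<alpha> i \<Longrightarrow> penalized_maximizer p f L (y i) (a i)"
      and a_lim: "(\<lambda>n. D (m (s' n))) \<longlonglongrightarrow> (\<Sum>i=1..N. \<alpha> i * dist (a i) (y i) powr p)"
      by blast
    have "R \<le> (\<Sum>i=1..N. \<alpha> i * dist (a i) (y i) powr p)"
      using D_gt by (intro LIMSEQ_le_const[OF a_lim]) (auto intro: less_imp_le)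
    then show ?thesis using that[of L b a] a b b_cost L0 by blast
  qed
qed

section \<open>Splitting one atom\<close>

text \<open>
  Turning \<open>B\<close> into \<open>A\<close> one index at a time moves the sum continuously from below \<open>R\<close> to above \<open>R\<close>,
  if each single exchange is made along a segment.
\<close>

lemma discrete_intermediate_value:
  fixes A B :: "nat \<Rightarrow> real"
  assumes "1 \<le> N" "(\<Sum>i=1..N. B i) \<le> R" "R \<le> (\<Sum>i=1..N. A i)"
  shows "\<exists>k\<in>{1..N}. \<exists>t\<in>{0..1}.
    (\<Sum>i=1..N. if i < k then A i else if i = k then (1 - t) * B k + t * A k else B i) = R"
  using assms
proof (induction N arbitrary: R rule: nat_induct_at_least)
  case base
  then have "B 1 \<le> R" "R \<le> A 1" by auto
  then have "R \<in> closed_segment (B 1) (A 1)" by (simp add: closed_segment_eq_real_ivl)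
  then obtain t where "t \<in> {0..1}" "R = (1 - t) * B 1 + t * A 1"
    by (auto simp: closed_segment_def)
  then show ?case by (intro bexI[of _ 1] bexI[of _ t]) auto
next
  case (Suc N)
  let ?F = "\<lambda>k t i. if i < k then A i else if i = k then (1 - t) * B k + t * A k else B i"
  show ?case
  proof (cases "R \<le> (\<Sum>i=1..N. A i) + B (Suc N)")
    case True
    obtain k t where k: "k \<in> {1..N}" "t \<in> {0..1}" "(\<Sum>i=1..N. ?F k t i) = R - B (Suc N)"
      using Suc.IH[of "R - B (Suc N)"] Suc.prems True by auto
    then have "(\<Sum>i=1..Suc N. ?F k t i) = R" by simp
    then show ?thesis using k by (intro bexI[of _ k] bexI[of _ t]) auto
  next
    case False
    let ?S = "\<Sum>i=1..N. A i"
    have "R - ?S \<in> closed_segment (B (Suc N)) (A (Suc N))"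
      using False Suc.prems by (simp add: closed_segment_eq_real_ivl)
    then obtain t where t: "t \<in> {0..1}" "R - ?S = (1 - t) * B (Suc N) + t * A (Suc N)"
      by (auto simp: closed_segment_def)
    have "(\<Sum>i=1..N. ?F (Suc N) t i) = ?S" by (intro sum.cong) auto
    then have "(\<Sum>i=1..Suc N. ?F (Suc N) t i) = R" using t by simp
    then show ?thesis using t by (intro bexI[of _ "Suc N"] bexI[of _ t]) auto
  qed
qed

text \<open>
  Index \<open>N + 1\<close> holds the part of the mass at node \<open>k\<close> that goes to \<open>a k\<close>. Keeping \<open>h\<close> arbitrary
  makes the identity usable both for the cost and for the marginal at the nodes.
\<close>

lemma sum_over_split_plan:
  fixes \<alpha> :: "nat \<Rightarrow> real"
  assumes "k \<in> {1..N}"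
  shows "(\<Sum>j=1..N+1. (if j = N+1 then t * \<alpha> k else if j = k then (1 - t) * \<alpha> k else \<alpha> j) *
        h (if j = N+1 then (a k :: 'a) else if j < k then a j else b j) (if j = N+1 then y k else y j :: 'b))
    = (\<Sum>i=1..N. if i < k then \<alpha> i * h (a i) (y i)
        else if i = k then (1 - t) * (\<alpha> k * h (b k) (y k)) + t * (\<alpha> k * h (a k) (y k))
        else \<alpha> i * (h (b i) (y i) :: real))" (is "_ = (\<Sum>i=1..N. ?F i)")
proof -
  let ?T = "t * (\<alpha> k * h (a k) (y k))"
  have "(\<Sum>i=1..N. ?F i) = (\<Sum>i=1..N. (?F i - (if i = k then ?T else 0)) + (if i = k then ?T else 0))"
    by simp
  also have "\<dots> = (\<Sum>i=1..N. ?F i - (if i = k then ?T else 0)) + ?T"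
    using assms by (subst sum.distrib) (simp add: sum.delta)
  also have "(\<Sum>i=1..N. ?F i - (if i = k then ?T else 0))
      = (\<Sum>j=1..N. (if j = k then (1 - t) * \<alpha> k else \<alpha> j) * h (if j < k then a j else b j) (y j))"
    by (intro sum.cong) auto
  finally show ?thesis using assms by (auto simp: mult.assoc intro!: sum.cong)
qed

theorem theorem4:
  fixes f :: "'a::polish_space \<Rightarrow> real"
    and p r c p' :: real
    and N :: nat
    and \<alpha> :: "nat \<Rightarrow> real"
    and y :: "nat \<Rightarrow> 'a"
    and x\<^sub>0 :: 'a
    and \<nu> :: "'a measure"
  assumes proper: "\<And>(x::'a) R. R > 0 \<Longrightarrow> compact (cball x R)"
    and p: "1 \<le> p"
    and r: "0 < r"
    and N: "1 \<le> N"
    and \<alpha>_nonneg: "\<And>i. i \<in> {1..N} \<Longrightarrow> 0 \<le> \<alpha> i"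
    and \<alpha>_sum: "(\<Sum>i=1..N. \<alpha> i) = 1"
    and \<nu>: "\<nu> = dirac_comb N \<alpha> y"
    and usc: "upper_semicontinuous f"
    and integral_defined: "\<And>\<mu>. \<mu> \<in> wasserstein_ball p r \<nu> \<Longrightarrow>
          (\<integral>\<^sup>+x. ennreal (max (f x) 0) \<partial>\<mu>) < \<infinity> \<or> (\<integral>\<^sup>+x. ennreal (max (- f x) 0) \<partial>\<mu>) < \<infinity>"
    and c: "0 < c"
    and p': "0 < p'" "p' < p"
    and growth: "\<And>x. f x \<le> c * (1 + dist x x\<^sub>0 powr p')"
  shows "\<exists>\<mu>\<^sub>s \<in> wasserstein_ball p r \<nu>.
           (\<forall>\<mu> \<in> wasserstein_ball p r \<nu>. ext_integral \<mu> f \<le> ext_integral \<mu>\<^sub>s f) \<and>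
           supported_on_at_most (N + 1) \<mu>\<^sub>s"
proof -
  have p0: "0 < p" and r0: "0 \<le> r" and R: "0 < r powr p" using p r by auto
  have ex: "\<exists>w. penalized_maximizer p f l v w" if "0 < l" for l v
    using penalized_maximizer_exists[OF proper usc _ p' growth that] c by auto
  \<comment> \<open>It remains to exhibit a plan with at most \<open>N + 1\<close> moves that satisfies the certificate.\<close>
  have plan: ?thesis
    if n: "n \<le> N + 1" and \<beta>: "\<And>j. j \<in> {1..n} \<Longrightarrow> 0 \<le> \<beta> j"
      and v: "dirac_comb n \<beta> v = \<nu>"
      and cost: "(\<Sum>j=1..n. \<beta> j * dist (w j) (v j) powr p) \<le> r powr p"
      and L: "0 \<le> L" "L = 0 \<or> (\<Sum>j=1..n. \<beta> j * dist (w j) (v j) powr p) = r powr p"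
      and max: "\<And>j. j \<in> {1..n} \<Longrightarrow> 0 < \<beta> j \<Longrightarrow> penalized_maximizer p f L (v j) (w j)"
      and \<beta>1: "(\<Sum>j=1..n. \<beta> j) = 1"
    for n \<beta> L and v w :: "nat \<Rightarrow> 'a"
  proof (intro bexI[of _ "dirac_comb n \<beta> w"] conjI ballI)
    show "supported_on_at_most (N + 1) (dirac_comb n \<beta> w)"
      unfolding supported_on_at_most_def using n \<beta> by blast
    show "dirac_comb n \<beta> w \<in> wasserstein_ball p r \<nu>"
      using dirac_comb_in_wasserstein_ball[OF p0 r0 \<beta> \<beta>1 cost] v by simp
    show "ext_integral \<mu> f \<le> ext_integral (dirac_comb n \<beta> w) f"
      if "\<mu> \<in> wasserstein_ball p r \<nu>" for \<mu>
      using transport_plan_optimal[OF upper_semicontinuous_borel_measurable[OF usc] p0 r0 L(1) \<beta> max L(2)]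
        that v by auto
  qed
  obtain L a b where L: "0 \<le> L"
    and b: "\<And>i. i \<in> {1..N} \<Longrightarrow> 0 < \<alpha> i \<Longrightarrow> penalized_maximizer p f L (y i) (b i)"
    and b_cost: "(\<Sum>i=1..N. \<alpha> i * dist (b i) (y i) powr p) \<le> r powr p"
    and a_cost: "0 < L \<Longrightarrow> r powr p \<le> (\<Sum>i=1..N. \<alpha> i * dist (a i) (y i) powr p)"
    and a: "\<And>i. 0 < L \<Longrightarrow> i \<in> {1..N} \<Longrightarrow> 0 < \<alpha> i \<Longrightarrow> penalized_maximizer p f L (y i) (a i)"
    by (rule critical_multiplier[OF proper usc p0 R \<alpha>_nonneg ex, where N = N and y = y]) blast+
  show ?thesis
  proof (cases "L = 0")
    case True
    then show ?thesis
      using plan[of N \<alpha> y b 0] \<alpha>_nonneg \<nu> b_cost b \<alpha>_sum by auto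
  next
    case False
    then have Lpos: "0 < L" using L by simp
    obtain k t where k: "k \<in> {1..N}" and t: "t \<in> {0..1}" and
      kt: "(\<Sum>i=1..N. if i < k then \<alpha> i * dist (a i) (y i) powr p
        else if i = k then (1 - t) * (\<alpha> k * dist (b k) (y k) powr p)
          + t * (\<alpha> k * dist (a k) (y k) powr p)
        else \<alpha> i * dist (b i) (y i) powr p) = r powr p"
      using discrete_intermediate_value[OF N b_cost a_cost[OF Lpos]] by blast
    define \<beta> where "\<beta> j = (if j = N+1 then t * \<alpha> k else if j = k then (1 - t) * \<alpha> k else \<alpha> j)" for j
    define w where "w j = (if j = N+1 then a k else if j < k then a j else b j)" for j
    define v where "v j = (if j = N+1 then y k else y j)" for j
    have split: "(\<Sum>j=1..N+1. \<beta> j * h (w j) (v j)) = (\<Sum>i=1..N. if i < k then \<alpha> i * h (a i) (y i)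
        else if i = k then (1 - t) * (\<alpha> k * h (b k) (y k)) + t * (\<alpha> k * h (a k) (y k))
        else \<alpha> i * h (b i) (y i))" for h
      unfolding \<beta>_def w_def v_def by (rule sum_over_split_plan[OF k])
    have merge: "(\<Sum>j=1..N+1. \<beta> j * h (v j)) = (\<Sum>i=1..N. \<alpha> i * h (y i))" for h
      unfolding split[of "\<lambda>_ u. h u"] by (intro sum.cong) (auto simp: algebra_simps)
    have \<beta>: "0 \<le> \<beta> j" if "j \<in> {1..N+1}" for j
      using that \<alpha>_nonneg k t by (auto simp: \<beta>_def)
    show ?thesis
    proof (rule plan[of "N+1" \<beta> v w L])
      show "0 \<le> \<beta> j" if "j \<in> {1..N+1}" for j by (rule \<beta>[OF that])
      show "dirac_comb (N+1) \<beta> v = \<nu>"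
        unfolding \<nu> by (rule dirac_comb_eqI[OF \<beta> \<alpha>_nonneg merge])
      show "(\<Sum>j=1..N+1. \<beta> j) = 1" using merge[of "\<lambda>_. 1"] \<alpha>_sum by simp
      show cost: "L = 0 \<or> (\<Sum>j=1..N+1. \<beta> j * dist (w j) (v j) powr p) = r powr p"
        using kt unfolding split[of "\<lambda>x u. dist x u powr p"] by blast
      show "(\<Sum>j=1..N+1. \<beta> j * dist (w j) (v j) powr p) \<le> r powr p" using cost False by simp
      show "penalized_maximizer p f L (v j) (w j)" if "j \<in> {1..N+1}" "0 < \<beta> j" for j
      proof -
        have "0 < \<alpha> (if j = N+1 then k else j)"
          using that t k \<alpha>_nonneg[of k] by (auto simp: \<beta>_def zero_less_mult_iff split: if_splits)
        then show ?thesis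
          using that(1) a[OF Lpos] b k by (auto simp: w_def v_def)
      qed
    qed (use L in auto)
  qed
qed

end
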